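(* Let $\mathcal R$ be a TRS and let $t\in\mathcal T_{\mathsf b}$ be a basic term. Let either ($\to\,=\,\to_{\mathcal R}$ and $\mathcal P=\mathrm{WDP}(\mathcal R)$) or ($\to\,=\,\xrightarrow{i}_{\mathcal R}$ and $\mathcal P=\mathrm{WIDP}(\mathcal R)$). If $t$ is terminating with respect to $\to$, then $\mathrm{dh}(t,\to)=\mathrm{dh}(t^\sharp,\to_{\mathcal P\cup\mathcal U(\mathcal P)})$.
   Context: Let $\mathcal F$ be a finite signature containing at least one constant and $\mathcal V$ a countably infinite set of variables. A TRS $\mathcal R$ is a finite set of rules $l\to r$ with $l\notin\mathcal V$, $\mathrm{Var}(r)\subseteq\mathrm{Var}(l)$; $\to_{\mathcal R}$ is its rewrite relation; $s\xrightarrow{i}_{\mathcal R}t$ (innermost rewriting) iff $s=C[l\sigma]$, $t=C[r\sigma]$ for some $l\to r\in\mathcal R$ with all proper subterms of $l\sigma$ normal forms of $\mathcal R$. The defined symbols $\mathcal D$ are the roots of left-hand sides, the constructors are $\mathcal C=\mathcal F\setminus\mathcal D$. A term $f(t_1,\dots,t_n)$ is basic if $f\in\mathcal D$ and all $t_i\in\mathcal T(\mathcal C,\mathcal V)$; $\mathcal T_{\mathsf b}$ is the set of basic terms. For a relation $\to$ well-founded and finitely branching on $s$, $\mathrm{dh}(s,\to)=\max\{n\mid\exists t.\ s\to^n t\}$. For a term $t$, $t^\sharp=t$ if $t$ is a variable and $t^\sharp=f^\sharp(t_1,\dots,t_n)$ if $t=f(t_1,\dots,t_n)$, with $f^\sharp$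 a fresh $n$-ary symbol. For a set $X$ of symbols/variables, every term is uniquely written $C[t_1,\dots,t_n]$ with $C$ an $n$-hole context containing no element of $X$ and each $t_i$ having root in $X$. $\mathrm{COM}(t_1)=t_1$, and $\mathrm{COM}(t_1,\dots,t_n)=c(t_1,\dots,t_n)$ for $n\neq1$ with $c$ a fresh $n$-ary compound symbol. $\mathrm{WDP}(\mathcal R)$ is the set of rules $l^\sharp\to\mathrm{COM}(u_1^\sharp,\dots,u_n^\sharp)$ for $l\to r\in\mathcal R$ with $r=C[u_1,\dots,u_n]$ decomposed w.r.t. $X=\mathcal D\cup\mathcal V$; $\mathrm{WIDP}(\mathcal R)$ is defined in the same way using $X=\mathcal D$. Usable rules: $f\rhd g$ if some rule $l\to r\in\mathcal R$ has root of $l$ equal to $f$ and $g\in\mathcal D$ occurs in $r$; $\mathcal U(t)$ is the set of rules of $\mathcal R$ whose left-hand side has root $g$ with $f\rhd^* g$ for some symbol $f$ occurring in $t$; for a set $\mathcal P$ of rules, $\mathcal U(\mathcal P)=\bigcup_{l\to r\in\mathcal P}\mathcal U(r)$.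
   Formalization: In the innermost case with P = WIDP(R), the relation on the right-hand side is innermost rewriting with respect to P ∪ U(P) instead of the full rewrite relation →_{P∪U(P)}, for which the equality fails; both derivation heights are also proved to be defined. *)

theory Defs
  imports Main "HOL-Library.Countable" "HOL-Library.Infinite_Typeclass"
begin

datatype (funs: 'f, vars: 'v) trm = Var 'v | Fun 'f "('f, 'v) trm list"

type_synonym ('f, 'v) rule = "('f, 'v) trm \<times> ('f, 'v) trm"

text \<open>A signature is a set \<open>F\<close> of symbols, each with its arity \<open>ar\<close>; \<open>terms_over F ar\<close> is
  the set of terms over \<open>F\<close> with variables from the type \<open>'v\<close>.\<close>

fun wf_trm :: "'f set \<Rightarrow> ('f \<Rightarrow> nat) \<Rightarrow> ('f, 'v) trm \<Rightarrow> bool" where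
  "wf_trm F ar (Var x) \<longleftrightarrow> True"
| "wf_trm F ar (Fun f ts) \<longleftrightarrow> f \<in> F \<and> length ts = ar f \<and> (\<forall>t \<in> set ts. wf_trm F ar t)"

definition terms_over :: "'f set \<Rightarrow> ('f \<Rightarrow> nat) \<Rightarrow> ('f, 'v) trm set" where
  "terms_over F ar = {t. wf_trm F ar t}"

fun root :: "('f, 'v) trm \<Rightarrow> 'f + 'v" where
  "root (Var x) = Inr x"
| "root (Fun f ts) = Inl f"

fun subst :: "('f, 'v) trm \<Rightarrow> ('v \<Rightarrow> ('f, 'v) trm) \<Rightarrow> ('f, 'v) trm" (infixl "\<cdot>" 67) where
  "Var x \<cdot> \<sigma> = \<sigma> x"
| "Fun f ts \<cdot> \<sigma> = Fun f (map (\<lambda>t. t \<cdot> \<sigma>) ts)"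

datatype ('f, 'v) ctxt = Hole | More 'f "('f, 'v) trm list" "('f, 'v) ctxt" "('f, 'v) trm list"

fun plug :: "('f, 'v) ctxt \<Rightarrow> ('f, 'v) trm \<Rightarrow> ('f, 'v) trm" where
  "plug Hole t = t"
| "plug (More f ss C us) t = Fun f (ss @ plug C t # us)"

definition proper_subterm :: "('f, 'v) trm \<Rightarrow> ('f, 'v) trm \<Rightarrow> bool" where
  "proper_subterm s t \<longleftrightarrow> (\<exists>C. C \<noteq> Hole \<and> t = plug C s)"

definition is_trs :: "'f set \<Rightarrow> ('f \<Rightarrow> nat) \<Rightarrow> ('f, 'v) rule set \<Rightarrow> bool" where
  "is_trs F ar R \<longleftrightarrow> finite R \<and>
     (\<forall>(l, r) \<in> R. l \<in> terms_over F ar \<and> r \<in> terms_over F ar \<and>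
        l \<notin> range Var \<and> vars r \<subseteq> vars l)"

definition rstep :: "('f, 'v) rule set \<Rightarrow> ('f, 'v) trm rel" where
  "rstep R = {(plug C (l \<cdot> \<sigma>), plug C (r \<cdot> \<sigma>)) | C l r \<sigma>. (l, r) \<in> R}"

definition normal_form :: "('f, 'v) rule set \<Rightarrow> ('f, 'v) trm \<Rightarrow> bool" where
  "normal_form R s \<longleftrightarrow> (\<nexists>t. (s, t) \<in> rstep R)"

definition irstep :: "('f, 'v) rule set \<Rightarrow> ('f, 'v) trm rel" where
  "irstep R = {(plug C (l \<cdot> \<sigma>), plug C (r \<cdot> \<sigma>)) | C l r \<sigma>. (l, r) \<in> R \<and>
     (\<forall>u. proper_subterm u (l \<cdot> \<sigma>) \<longrightarrow> normal_form R u)}"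

definition defined :: "('f, 'v) rule set \<Rightarrow> 'f set" where
  "defined R = {f. \<exists>(l, r) \<in> R. root l = Inl f}"

definition basic_terms :: "'f set \<Rightarrow> ('f \<Rightarrow> nat) \<Rightarrow> ('f, 'v) rule set \<Rightarrow> ('f, 'v) trm set" where
  "basic_terms F ar R = {Fun f ts | f ts. Fun f ts \<in> terms_over F ar \<and> f \<in> defined R \<and>
     set ts \<subseteq> terms_over (F - defined R) ar}"

definition terminating_on :: "'a rel \<Rightarrow> 'a \<Rightarrow> bool" where
  "terminating_on r s \<longleftrightarrow> (\<nexists>a :: nat \<Rightarrow> 'a. a 0 = s \<and> (\<forall>i. (a i, a (Suc i)) \<in> r))"

definition finitely_branching_on :: "'a rel \<Rightarrow> 'a \<Rightarrow> bool" where
  "finitely_branching_on r s \<longleftrightarrow> (\<forall>u. (s, u) \<in> r\<^sup>* \<longrightarrow> finite {v. (u, v) \<in> r})"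

text \<open>The number \<open>dh s r\<close> is meaningful only under \<open>dh_defined s r\<close>: otherwise the set below
  need not be finite, and \<open>Max\<close> of an infinite set is an unspecified number.\<close>

definition dh_defined :: "'a \<Rightarrow> 'a rel \<Rightarrow> bool" where
  "dh_defined s r \<longleftrightarrow> terminating_on r s \<and> finitely_branching_on r s"

definition dh :: "'a \<Rightarrow> 'a rel \<Rightarrow> nat" where
  "dh s r = Max {n. \<exists>t. (s, t) \<in> r ^^ n}"

datatype ('f, 'v) mctxt = MHole | MVar 'v | MFun 'f "('f, 'v) mctxt list"

text \<open>\<open>fills C ts t\<close> means that \<open>t\<close> is \<open>C\<close> with its holes replaced, from left to right, by the
  members of the list \<open>ts\<close>, which has as many members as \<open>C\<close> has holes.\<close>

inductive fills :: "('f, 'v) mctxt \<Rightarrow> ('f, 'v) trm list \<Rightarrow> ('f, 'v) trm \<Rightarrow> bool"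
  and fills_list :: "('f, 'v) mctxt list \<Rightarrow> ('f, 'v) trm list \<Rightarrow> ('f, 'v) trm list \<Rightarrow> bool" where
  "fills MHole [t] t"
| "fills (MVar x) [] (Var x)"
| "fills_list Cs us ts \<Longrightarrow> fills (MFun f Cs) us (Fun f ts)"
| "fills_list [] [] []"
| "fills C us t \<Longrightarrow> fills_list Cs us' ts \<Longrightarrow> fills_list (C # Cs) (us @ us') (t # ts)"

fun symbols_mctxt :: "('f, 'v) mctxt \<Rightarrow> ('f + 'v) set" where
  "symbols_mctxt MHole = {}"
| "symbols_mctxt (MVar x) = {Inr x}"
| "symbols_mctxt (MFun f Cs) = insert (Inl f) (\<Union>C \<in> set Cs. symbols_mctxt C)"

definition decomposes :: "('f + 'v) set \<Rightarrow> ('f, 'v) trm \<Rightarrow> ('f, 'v) mctxt \<Rightarrow> ('f, 'v) trm list \<Rightarrow> bool"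
  where "decomposes X t C ts \<longleftrightarrow>
     fills C ts t \<and> symbols_mctxt C \<inter> X = {} \<and> (\<forall>u \<in> set ts. root u \<in> X)"

text \<open>The extended signature: original symbols, their marked copies, and compound symbols. A
  compound symbol is given by a label and its arity.\<close>

datatype ('f, 'c) dpsym = Orig 'f | Sharp 'f | Com 'c nat

abbreviation lift_trm :: "('f, 'v) trm \<Rightarrow> (('f, 'c) dpsym, 'v) trm" where
  "lift_trm \<equiv> map_trm Orig id"

definition lift_rules :: "('f, 'v) rule set \<Rightarrow> (('f, 'c) dpsym, 'v) rule set" where
  "lift_rules R = {(lift_trm l, lift_trm r) | l r. (l, r) \<in> R}"

fun sharp :: "('f, 'v) trm \<Rightarrow> (('f, 'c) dpsym, 'v) trm" where
  "sharp (Var x) = Var x"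
| "sharp (Fun f ts) = Fun (Sharp f) (map lift_trm ts)"

definition COM :: "'c \<Rightarrow> (('f, 'c) dpsym, 'v) trm list \<Rightarrow> (('f, 'c) dpsym, 'v) trm" where
  "COM c ts = (if length ts = 1 then hd ts else Fun (Com c (length ts)) ts)"

text \<open>The function \<open>\<gamma>\<close> chooses the label of the compound symbol for each rule, so the rules may
  have pairwise different compound symbols (\<open>\<gamma>\<close> injective) or share one symbol per arity
  (\<open>\<gamma>\<close> constant).\<close>

definition weak_pairs ::
  "('f + 'v) set \<Rightarrow> (('f, 'v) rule \<Rightarrow> 'c) \<Rightarrow> ('f, 'v) rule set \<Rightarrow> (('f, 'c) dpsym, 'v) rule set" where
  "weak_pairs X \<gamma> R =
     {(sharp l, COM (\<gamma> (l, r)) (map sharp us)) | l r C us. (l, r) \<in> R \<and> decomposes X r C us}"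

definition WDP ::
  "(('f, 'v) rule \<Rightarrow> 'c) \<Rightarrow> ('f, 'v) rule set \<Rightarrow> (('f, 'c) dpsym, 'v) rule set" where
  "WDP \<gamma> R = weak_pairs (Inl ` defined R \<union> range Inr) \<gamma> R"

definition WIDP ::
  "(('f, 'v) rule \<Rightarrow> 'c) \<Rightarrow> ('f, 'v) rule set \<Rightarrow> (('f, 'c) dpsym, 'v) rule set" where
  "WIDP \<gamma> R = weak_pairs (Inl ` defined R) \<gamma> R"

definition depends :: "('f, 'v) rule set \<Rightarrow> 'f rel" where
  "depends R = {(f, g). \<exists>(l, r) \<in> R. root l = Inl f \<and> g \<in> defined R \<inter> funs r}"

definition usable :: "('f, 'v) rule set \<Rightarrow> ('f, 'v) trm \<Rightarrow> ('f, 'v) rule set" where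
  "usable R t = {(l, r) \<in> R. \<exists>f \<in> funs t. \<exists>g. (f, g) \<in> (depends R)\<^sup>* \<and> root l = Inl g}"

definition usable_rules ::
  "('f, 'v) rule set \<Rightarrow> ('f, 'v) rule set \<Rightarrow> ('f, 'v) rule set" where
  "usable_rules R P = (\<Union>(l, r) \<in> P. usable R r)"

end

theory Submission
  imports Defs
begin

text \<open>A term \<open>s\<close> reachable from \<open>t\<close> is matched with a term over the extended signature in which
  every maximal piece of \<open>s\<close> that can still be rewritten appears either marked or unmarked below
  compound symbols. Constructor positions, and in the innermost case instances of variables,
  cannot be rewritten and are dropped. All symbols below the marked roots that are defined have
  their rules among the usable ones, because they stem from right-hand sides of \<open>P\<close> or of usable
  rules. This correspondence is a bisimulation, so derivations on both sides have the same
  lengths.\<close>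

subsection \<open>Terms, contexts and rewriting\<close>

text \<open>Two obstacles shape the proof. In full rewriting an instance of a variable may still
  contain redexes, so it has to be kept, yet a variable carries no mark. Pieces with a defined root
  can therefore be unmarked, and even their root steps have to come from usable rules instead of
  pairs. In innermost rewriting, normality on the extended side refers to
  \<open>P \<union> U\<close>, which may contain lifts of only some rules of \<open>R\<close>, so a
  term could be normal there without being normal for \<open>R\<close>. One invariant answers both:
  below marks and in unmarked pieces only symbols from \<open>usable_syms\<close> occur. It supplies
  the rule for every step that has to be copied, and it makes the two notions of normal form agree.
  The correspondence is a relation and not a function, since the shape of a piece depends on its
  history. A normal form, for example, is dropped when it instantiates a variable in an innermost
  step, but is kept when it is an argument of a marked term.\<close>

lemma funs_subst: "funs (t \<cdot> \<sigma>) = funs t \<union> (\<Union>x \<in> vars t. funs (\<sigma> x))"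
  by (induction t) auto

lemma subst_cong: "(\<And>x. x \<in> vars t \<Longrightarrow> \<sigma> x = \<tau> x) \<Longrightarrow> t \<cdot> \<sigma> = t \<cdot> \<tau>"
  by (induction t) auto

lemma subst_eqD: "t \<cdot> \<sigma> = t \<cdot> \<tau> \<Longrightarrow> x \<in> vars t \<Longrightarrow> \<sigma> x = \<tau> x"
  by (induction t) auto

lemma map_trm_subst: "map_trm f id (t \<cdot> \<sigma>) = map_trm f id t \<cdot> (\<lambda>x. map_trm f id (\<sigma> x))"
  by (induction t) auto

lemma map_trm_plug: "map_trm f g (plug C t) = plug (map_ctxt f g C) (map_trm f g t)"
  by (induction C) auto

lemma funs_plug: "funs (plug C t) = set1_ctxt C \<union> funs t"
  by (induction C) auto

lemma proper_subterm_Fun: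
  "proper_subterm u (Fun f ts) \<longleftrightarrow> (\<exists>t \<in> set ts. \<exists>C. t = plug C u)"
proof
  assume "proper_subterm u (Fun f ts)"
  then obtain C where "C \<noteq> Hole" "Fun f ts = plug C u"
    unfolding proper_subterm_def by blast
  then show "\<exists>t \<in> set ts. \<exists>C. t = plug C u"
    by (cases C) auto
next
  assume "\<exists>t \<in> set ts. \<exists>C. t = plug C u"
  then obtain ss C us where "ts = ss @ plug C u # us"
    by (metis split_list)
  then have "Fun f ts = plug (More f ss C us) u"
    by simp
  then show "proper_subterm u (Fun f ts)"
    unfolding proper_subterm_def by blast
qed

lemma not_proper_subterm_Var: "\<not> proper_subterm u (Var x)"
proof
  assume "proper_subterm u (Var x)"
  then obtain C where "C \<noteq> Hole" "Var x = plug C u"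
    unfolding proper_subterm_def by blast
  then show False by (cases C) auto
qed

section \<open>One step relation for full and innermost rewriting\<close>

definition args_normal :: "('f, 'v) rule set \<Rightarrow> ('f, 'v) trm \<Rightarrow> bool" where
  "args_normal S s \<longleftrightarrow> (\<forall>u. proper_subterm u s \<longrightarrow> normal_form S u)"

lemma args_normal_Fun:
  "args_normal S (Fun f ts) \<longleftrightarrow> (\<forall>t \<in> set ts. \<forall>C u. t = plug C u \<longrightarrow> normal_form S u)"
  unfolding args_normal_def proper_subterm_Fun by blast

text \<open>In \<open>Fun f ts\<close> a variable occurs strictly below the root, so its instance is
  a proper subterm of the redex. This is what permits the innermost decomposition to ignore
  variables.\<close>

lemma args_normal_var:
  assumes "args_normal S (Fun f ts \<cdot> \<sigma>)" and "x \<in> vars (Fun f ts)"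
  shows "normal_form S (\<sigma> x)"
proof -
  have *: "\<exists>C. t \<cdot> \<sigma> = plug C (\<sigma> x)" if "x \<in> vars t" for t :: "('a, 'b) trm"
    using that
  proof (induction t)
    case (Var y)
    then have "Var y \<cdot> \<sigma> = plug Hole (\<sigma> x)" by simp
    then show ?case by blast
  next
    case (Fun g ss)
    then obtain s where s: "s \<in> set ss" "x \<in> vars s" by auto
    then obtain C where C: "s \<cdot> \<sigma> = plug C (\<sigma> x)" using Fun.IH by blast
    from s obtain as bs where "ss = as @ s # bs" by (meson split_list)
    then have "Fun g ss \<cdot> \<sigma> =
        plug (More g (map (\<lambda>t. t \<cdot> \<sigma>) as) C (map (\<lambda>t. t \<cdot> \<sigma>) bs)) (\<sigma> x)"
      using C by simp
    then show ?case by blast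
  qed
  from assms(2) obtain t where "t \<in> set ts" "x \<in> vars t" by auto
  then show ?thesis
    using * assms(1) by (fastforce simp: args_normal_Fun)
qed

text \<open>The flag \<open>inn\<close> lets both kinds of rewriting share one proof. Normality is
  taken with respect to \<open>S\<close> itself, so normal forms of different rule sets have to be
  compared later.\<close>

definition step_of :: "bool \<Rightarrow> ('f, 'v) rule set \<Rightarrow> ('f, 'v) trm rel" where
  "step_of inn S = {(plug C (l \<cdot> \<sigma>), plug C (r \<cdot> \<sigma>)) | C l r \<sigma>. (l, r) \<in> S \<and>
     (inn \<longrightarrow> args_normal S (l \<cdot> \<sigma>))}"

lemma step_of_False: "step_of False S = rstep S"
  unfolding step_of_def rstep_def by simp

lemma step_of_True: "step_of True S = irstep S"
  unfolding step_of_def irstep_def args_normal_def by simp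

lemma step_of_subset_rstep: "step_of inn S \<subseteq> rstep S"
  unfolding step_of_def rstep_def by blast

lemma step_of_root:
  "(l, r) \<in> S \<Longrightarrow> (inn \<Longrightarrow> args_normal S (l \<cdot> \<sigma>)) \<Longrightarrow> (l \<cdot> \<sigma>, r \<cdot> \<sigma>) \<in> step_of inn S"
  unfolding step_of_def by (intro CollectI exI[of _ Hole] exI[of _ l] exI[of _ r] exI[of _ \<sigma>]) simp

text \<open>It serves twice: for steps inside the arguments of a symbol, and for steps of a list of
  pieces.\<close>

definition list_step :: "'a rel \<Rightarrow> 'a list rel" where
  "list_step r = {(as @ s # bs, as @ s' # bs) | as s s' bs. (s, s') \<in> r}"

lemma list_step_Nil: "([], ts) \<notin> list_step r"
  unfolding list_step_def by simp

lemma list_step_Cons: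
  "(t # ts, us) \<in> list_step r \<longleftrightarrow>
    (\<exists>t'. us = t' # ts \<and> (t, t') \<in> r) \<or> (\<exists>ts'. us = t # ts' \<and> (ts, ts') \<in> list_step r)"
proof
  assume "(t # ts, us) \<in> list_step r"
  then obtain as s s' bs where *: "t # ts = as @ s # bs" "us = as @ s' # bs" "(s, s') \<in> r"
    unfolding list_step_def by blast
  then show "(\<exists>t'. us = t' # ts \<and> (t, t') \<in> r) \<or> (\<exists>ts'. us = t # ts' \<and> (ts, ts') \<in> list_step r)"
    unfolding list_step_def by (cases as) auto
next
  assume "(\<exists>t'. us = t' # ts \<and> (t, t') \<in> r) \<or> (\<exists>ts'. us = t # ts' \<and> (ts, ts') \<in> list_step r)"
  then show "(t # ts, us) \<in> list_step r"
  proof (elim disjE exE conjE)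
    fix t' assume "us = t' # ts" "(t, t') \<in> r"
    then show ?thesis unfolding list_step_def by (auto intro!: exI[of _ "[]"])
  next
    fix ts' assume us: "us = t # ts'" and "(ts, ts') \<in> list_step r"
    then obtain as s s' bs where "ts = as @ s # bs" "ts' = as @ s' # bs" "(s, s') \<in> r"
      unfolding list_step_def by blast
    with us have "t # ts = (t # as) @ s # bs" "us = (t # as) @ s' # bs" "(s, s') \<in> r"
      by simp_all
    then show ?thesis unfolding list_step_def by blast
  qed
qed

lemma list_step_append:
  "(ts @ us, vs) \<in> list_step r \<longleftrightarrow>
    (\<exists>ts'. vs = ts' @ us \<and> (ts, ts') \<in> list_step r) \<or>
    (\<exists>us'. vs = ts @ us' \<and> (us, us') \<in> list_step r)"
proof (induction ts arbitrary: vs)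
  case Nil
  then show ?case by (simp add: list_step_Nil)
next
  case (Cons t ts)
  show ?case
    by (simp only: append_Cons list_step_Cons Cons.IH) (auto simp: list_step_Cons)
qed

lemma list_step_singleton: "([t], us) \<in> list_step r \<longleftrightarrow> (\<exists>t'. us = [t'] \<and> (t, t') \<in> r)"
  by (simp add: list_step_Cons list_step_Nil)

lemma step_of_args:
  assumes "(ts, ts') \<in> list_step (step_of inn S)"
  shows "(Fun f ts, Fun f ts') \<in> step_of inn S"
proof -
  obtain as s s' bs where ts: "ts = as @ s # bs" "ts' = as @ s' # bs"
    and "(s, s') \<in> step_of inn S"
    using assms unfolding list_step_def by blast
  then obtain C l r \<sigma> where "s = plug C (l \<cdot> \<sigma>)" "s' = plug C (r \<cdot> \<sigma>)" "(l, r) \<in> S"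
    "inn \<longrightarrow> args_normal S (l \<cdot> \<sigma>)"
    unfolding step_of_def by blast
  moreover from this ts have "Fun f ts = plug (More f as C bs) (l \<cdot> \<sigma>)"
    "Fun f ts' = plug (More f as C bs) (r \<cdot> \<sigma>)"
    by auto
  ultimately show ?thesis unfolding step_of_def by blast
qed

lemma step_of_FunE:
  assumes "(Fun f ts, t') \<in> step_of inn S"
  obtains (root) l r \<sigma> where "(l, r) \<in> S" "Fun f ts = l \<cdot> \<sigma>" "t' = r \<cdot> \<sigma>"
      "inn \<longrightarrow> args_normal S (Fun f ts)"
    | (args) ts' where "t' = Fun f ts'" "(ts, ts') \<in> list_step (step_of inn S)"
proof -
  obtain C l r \<sigma> where *: "Fun f ts = plug C (l \<cdot> \<sigma>)" "t' = plug C (r \<cdot> \<sigma>)" "(l, r) \<in> S"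
    "inn \<longrightarrow> args_normal S (l \<cdot> \<sigma>)"
    using assms unfolding step_of_def by blast
  show thesis
  proof (cases C)
    case Hole
    then show thesis using root[of l r \<sigma>] * by simp
  next
    case (More g as D bs)
    have "(plug D (l \<cdot> \<sigma>), plug D (r \<cdot> \<sigma>)) \<in> step_of inn S"
      using * unfolding step_of_def by blast
    then have "(ts, as @ plug D (r \<cdot> \<sigma>) # bs) \<in> list_step (step_of inn S)"
      using More * unfolding list_step_def by auto
    then show thesis using args More * by simp
  qed
qed

section \<open>Finite branching\<close>

lemma finite_root_steps:
  assumes "finite S" and vars: "\<And>l r. (l, r) \<in> S \<Longrightarrow> vars r \<subseteq> vars l"
  shows "finite {r \<cdot> \<sigma> | l r \<sigma>. (l, r) \<in> S \<and> u = l \<cdot> \<sigma>}"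
proof (rule finite_subset)
  \<comment> \<open>The term \<open>u\<close> fixes a matcher only on the variables of
    \<open>l\<close>. As \<open>r\<close> has no others, an arbitrarily chosen matcher yields the
    same contractum, so each rule contributes at most one.\<close>
  define inst where "inst = (\<lambda>(l, r). r \<cdot> (SOME \<sigma>. u = l \<cdot> \<sigma>) :: ('a, 'b) trm)"
  show "finite (inst ` S)" using assms(1) by simp
  show "{r \<cdot> \<sigma> | l r \<sigma>. (l, r) \<in> S \<and> u = l \<cdot> \<sigma>} \<subseteq> inst ` S"
  proof clarify
    fix l r \<sigma> assume lr: "(l, r) \<in> S" and u: "u = l \<cdot> \<sigma>"
    define \<tau> where "\<tau> = (SOME \<tau>. u = l \<cdot> \<tau>)"
    have "u = l \<cdot> \<tau>" unfolding \<tau>_def by (rule someI[of "\<lambda>\<tau>. u = l \<cdot> \<tau>"]) (rule u)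
    with u have "l \<cdot> \<sigma> = l \<cdot> \<tau>" by simp
    then have "\<sigma> x = \<tau> x" if "x \<in> vars r" for x
      using subst_eqD vars[OF lr] that by (metis subsetD)
    then have "r \<cdot> \<sigma> = r \<cdot> \<tau>"
      by (rule subst_cong)
    then have "r \<cdot> \<sigma> = inst (l, r)"
      by (simp add: inst_def \<tau>_def)
    with lr show "r \<cdot> \<sigma> \<in> inst ` S" by blast
  qed
qed

lemma finite_step_of:
  assumes "finite S" and "\<And>l r. (l, r) \<in> S \<Longrightarrow> vars r \<subseteq> vars l"
  shows "finite {v. (u, v) \<in> step_of inn S}"
proof (induction u)
  case (Var x)
  have "{v. (Var x, v) \<in> step_of inn S} \<subseteq> {r \<cdot> \<sigma> | l r \<sigma>. (l, r) \<in> S \<and> Var x = l \<cdot> \<sigma>}"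
  proof
    fix v assume "v \<in> {v. (Var x, v) \<in> step_of inn S}"
    then obtain C l r \<sigma> where *: "Var x = plug C (l \<cdot> \<sigma>)" "v = plug C (r \<cdot> \<sigma>)" "(l, r) \<in> S"
      unfolding step_of_def by blast
    then have "C = Hole" by (cases C) auto
    with * show "v \<in> {r \<cdot> \<sigma> | l r \<sigma>. (l, r) \<in> S \<and> Var x = l \<cdot> \<sigma>}" by auto
  qed
  then show ?case using finite_root_steps[OF assms] finite_subset by blast
next
  case (Fun f ts)
  have "{v. (Fun f ts, v) \<in> step_of inn S} \<subseteq>
      {r \<cdot> \<sigma> | l r \<sigma>. (l, r) \<in> S \<and> Fun f ts = l \<cdot> \<sigma>} \<union>
      (\<Union>i < length ts. (\<lambda>v. Fun f (ts[i := v])) ` {v. (ts ! i, v) \<in> step_of inn S})"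
  proof
    fix v assume "v \<in> {v. (Fun f ts, v) \<in> step_of inn S}"
    then have "(Fun f ts, v) \<in> step_of inn S" by simp
    then show "v \<in> {r \<cdot> \<sigma> | l r \<sigma>. (l, r) \<in> S \<and> Fun f ts = l \<cdot> \<sigma>} \<union>
      (\<Union>i < length ts. (\<lambda>v. Fun f (ts[i := v])) ` {v. (ts ! i, v) \<in> step_of inn S})"
    proof (cases rule: step_of_FunE)
      case (root l r \<sigma>)
      then show ?thesis by blast
    next
      case (args ts')
      then obtain as s s' bs where "ts = as @ s # bs" "ts' = as @ s' # bs"
        "(s, s') \<in> step_of inn S"
        unfolding list_step_def by blast
      with args have "length as < length ts" "v = Fun f (ts[length as := s'])"
        "(ts ! length as, s') \<in> step_of inn S"
        by auto
      then show ?thesis by blast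
    qed
  qed
  moreover have "finite (\<Union>i < length ts.
      (\<lambda>v. Fun f (ts[i := v])) ` {v. (ts ! i, v) \<in> step_of inn S})"
    using Fun.IH by (intro finite_UN_I finite_imageI) auto
  ultimately show ?case
    using finite_root_steps[OF assms] finite_subset finite_UnI by blast
qed

subsection \<open>Lifting to the extended signature\<close>

text \<open>Symbols outside the range of \<open>Orig\<close> are sent to junk.\<close>

definition unlift_trm :: "(('f, 'c) dpsym, 'v) trm \<Rightarrow> ('f, 'v) trm" where
  "unlift_trm = map_trm (\<lambda>g. case g of Orig f \<Rightarrow> f | _ \<Rightarrow> undefined) id"

lemma unlift_simps [simp]:
  "unlift_trm (Var x) = Var x"
  "unlift_trm (Fun (Orig f) ws) = Fun f (map unlift_trm ws)"
  by (simp_all add: unlift_trm_def)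

lemma unlift_lift [simp]: "unlift_trm (lift_trm t) = t"
  by (induction t) (auto simp: map_idI)

lemma lift_unlift: "funs w \<subseteq> range Orig \<Longrightarrow> lift_trm (unlift_trm w) = w"
proof (induction w)
  case (Fun g ws)
  moreover from this obtain f where "g = Orig f" by auto
  ultimately show ?case by (simp add: map_idI UN_subset_iff)
qed simp

lemma unlift_subst: "unlift_trm (t \<cdot> \<sigma>) = unlift_trm t \<cdot> (\<lambda>x. unlift_trm (\<sigma> x))"
  unfolding unlift_trm_def by (rule map_trm_subst)

lemma funs_lift: "funs (lift_trm t) = Orig ` funs t"
  by (rule trm.set_map(1))

lemma vars_lift [simp]: "vars (lift_trm t) = vars t"
  by (simp add: trm.set_map)

text \<open>On the variables of \<open>l\<close>, the values of \<open>\<tau>\<close> are pieces of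
  a lifted term and hence lifted themselves; elsewhere \<open>\<tau>\<close> is unconstrained, which
  is why \<open>t\<close> may use only variables of \<open>l\<close>.\<close>

lemma lift_subst_cong:
  assumes "lift_trm l \<cdot> \<tau> = lift_trm s" and "vars t \<subseteq> vars l"
  shows "t \<cdot> \<tau> = t \<cdot> (\<lambda>x. lift_trm (unlift_trm (\<tau> x)))"
proof (intro subst_cong)
  fix x assume "x \<in> vars t"
  then have "funs (\<tau> x) \<subseteq> funs (lift_trm l \<cdot> \<tau>)"
    using assms(2) by (auto simp: funs_subst)
  then show "\<tau> x = lift_trm (unlift_trm (\<tau> x))"
    unfolding assms(1) funs_lift by (intro lift_unlift[symmetric]) auto
qed

lemma vars_sharp: "vars (sharp t) = vars t"
  by (cases t) auto

subsection \<open>Computing weak dependency pairs\<close>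

text \<open>Functional form of the decomposition: the descent stops at the topmost positions with
  root in \<open>X\<close>.\<close>

fun parts :: "('f + 'v) set \<Rightarrow> ('f, 'v) trm \<Rightarrow> ('f, 'v) trm list" where
  "parts X (Var x) = (if Inr x \<in> X then [Var x] else [])"
| "parts X (Fun f ts) = (if Inl f \<in> X then [Fun f ts] else concat (map (parts X) ts))"

lemma decomposes_parts: "\<exists>C. decomposes X t C (parts X t)"
proof (induction t)
  case (Var x)
  have "decomposes X (Var x) (if Inr x \<in> X then MHole else MVar x) (parts X (Var x))"
    by (auto simp: decomposes_def intro: fills_fills_list.intros)
  then show ?case by blast
next
  case (Fun f ts)
  \<comment> \<open>Generalised from \<open>ts\<close> to lists of its members, so that the outer
    induction hypothesis applies to every head in the inner induction.\<close>
  have "\<exists>Cs. fills_list Cs (concat (map (parts X) us)) us \<and>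
      (\<forall>C \<in> set Cs. symbols_mctxt C \<inter> X = {}) \<and>
      (\<forall>u \<in> set (concat (map (parts X) us)). root u \<in> X)" if "set us \<subseteq> set ts" for us
    using that
  proof (induction us)
    case Nil
    have "fills_list [] [] []" by (rule fills_fills_list.intros)
    then show ?case by (intro exI[of _ "[]"]) simp
  next
    case (Cons u us)
    then obtain Cs where Cs: "fills_list Cs (concat (map (parts X) us)) us"
      "\<forall>C \<in> set Cs. symbols_mctxt C \<inter> X = {}"
      "\<forall>u \<in> set (concat (map (parts X) us)). root u \<in> X" by auto
    moreover from Cons.prems Fun.IH[of u] obtain C where C: "decomposes X u C (parts X u)"
      by auto
    ultimately have "fills_list (C # Cs) (concat (map (parts X) (u # us))) (u # us)"
      by (auto simp: decomposes_def intro: fills_fills_list.intros)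
    with Cs C show ?case
      by (intro exI[of _ "C # Cs"]) (auto simp: decomposes_def)
  qed
  from this[of ts] obtain Cs where Cs: "fills_list Cs (concat (map (parts X) ts)) ts"
    "\<forall>C \<in> set Cs. symbols_mctxt C \<inter> X = {}"
    "\<forall>u \<in> set (concat (map (parts X) ts)). root u \<in> X" by auto
  show ?case
  proof (cases "Inl f \<in> X")
    case True
    then have "decomposes X (Fun f ts) MHole (parts X (Fun f ts))"
      by (auto simp: decomposes_def intro: fills_fills_list.intros)
    then show ?thesis by blast
  next
    case False
    then have "decomposes X (Fun f ts) (MFun f Cs) (parts X (Fun f ts))"
      using Cs by (auto simp: decomposes_def intro: fills_fills_list.intros)
    then show ?thesis by blast
  qed
qed

text \<open>Outside its holes the context avoids \<open>X\<close>, and every filler has its root in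
  \<open>X\<close>. The holes therefore sit exactly where \<open>parts\<close> ends its descent,
  which gives uniqueness.\<close>

lemma fills_parts:
  "fills C us t \<Longrightarrow> symbols_mctxt C \<inter> X = {} \<Longrightarrow> \<forall>u \<in> set us. root u \<in> X \<Longrightarrow> us = parts X t"
  and fills_list_parts:
  "fills_list Cs us ts \<Longrightarrow> \<forall>C \<in> set Cs. symbols_mctxt C \<inter> X = {} \<Longrightarrow>
    \<forall>u \<in> set us. root u \<in> X \<Longrightarrow> us = concat (map (parts X) ts)"
proof (induction rule: fills_fills_list.inducts)
  case (1 t)
  then show ?case by (cases t) auto
next
  case (3 Cs us ts f)
  have "Inl f \<notin> X" using "3.prems"(1) by simp
  moreover have "\<forall>C \<in> set Cs. symbols_mctxt C \<inter> X = {}" using "3.prems"(1) by auto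
  then have "us = concat (map (parts X) ts)" by (rule "3.IH"[OF _ "3.prems"(2)])
  ultimately show ?case by simp
next
  case (5 C us t Cs us' ts)
  then have "us = parts X t" "us' = concat (map (parts X) ts)" by simp_all
  then show ?case by simp
qed simp_all

lemma decomposes_iff_parts: "(\<exists>C. decomposes X t C us) \<longleftrightarrow> us = parts X t"
  using decomposes_parts[of X t] fills_parts[of _ us t X] unfolding decomposes_def by blast

text \<open>Since the decomposition is unique, each rule yields one pair, and finiteness passes from
  \<open>R\<close> to its pairs.\<close>

lemma weak_pairs_parts:
  "weak_pairs X \<gamma> R = (\<lambda>(l, r). (sharp l, COM (\<gamma> (l, r)) (map sharp (parts X r)))) ` R"
proof -
  have "weak_pairs X \<gamma> R = {(sharp l, COM (\<gamma> (l, r)) (map sharp us)) | l r us. (l, r) \<in> R \<and>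
      (\<exists>C. decomposes X r C us)}"
    unfolding weak_pairs_def by blast
  then show ?thesis
    unfolding decomposes_iff_parts by auto
qed

lemma vars_parts: "u \<in> set (parts X t) \<Longrightarrow> vars u \<subseteq> vars t"
  by (induction t) (auto split: if_splits)

subsection \<open>The bisimulation\<close>

locale weak_pairs_of_trs =
  fixes R :: "('f, 'v) rule set" and inn :: bool and \<gamma> :: "('f, 'v) rule \<Rightarrow> 'c"
  assumes lhs_Fun: "(l, r) \<in> R \<Longrightarrow> \<exists>f ls. l = Fun f ls"
    and vars_rhs: "(l, r) \<in> R \<Longrightarrow> vars r \<subseteq> vars l"
begin

definition X :: "('f + 'v) set" where
  "X = Inl ` defined R \<union> (if inn then {} else range Inr)"

definition P :: "(('f, 'c) dpsym, 'v) rule set" where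
  "P = weak_pairs X \<gamma> R"

definition U :: "(('f, 'c) dpsym, 'v) rule set" where
  "U = usable_rules (lift_rules R) P"

lemma in_P:
  "(l', r') \<in> P \<longleftrightarrow>
    (\<exists>l r. (l, r) \<in> R \<and> l' = sharp l \<and> r' = COM (\<gamma> (l, r)) (map sharp (parts X r)))"
  unfolding P_def weak_pairs_parts by auto

lemma in_U:
  "(l', r') \<in> U \<longleftrightarrow> (l', r') \<in> lift_rules R \<and>
    (\<exists>(lp, rp) \<in> P. \<exists>f \<in> funs rp. \<exists>g. (f, g) \<in> (depends (lift_rules R))\<^sup>* \<and> root l' = Inl g)"
  unfolding U_def usable_rules_def usable_def by auto

lemma root_lift: "root (lift_trm t) = Inl g \<longleftrightarrow> (\<exists>f. g = Orig f \<and> root t = Inl f)"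
  by (cases t) auto

text \<open>Needed for finite branching on the extended side, and in \<open>simulated\<close> to
  control the matcher of a pair.\<close>

lemma vars_extended_rhs:
  assumes "(l', r') \<in> P \<union> U"
  shows "vars r' \<subseteq> vars l'"
proof -
  consider (P) l r where "(l, r) \<in> R" "l' = sharp l" "r' = COM (\<gamma> (l, r)) (map sharp (parts X r))"
    | (U) "(l', r') \<in> lift_rules R"
    using assms in_P in_U by blast
  then show ?thesis
  proof cases
    case P
    have "vars r' \<subseteq> (\<Union>u \<in> set (parts X r). vars u)"
      unfolding P(3) COM_def by (cases "parts X r") (auto simp: vars_sharp)
    also have "\<dots> \<subseteq> vars l"
      using vars_parts vars_rhs[OF P(1)] by blast
    finally show ?thesis by (simp add: P(2) vars_sharp)
  next
    case U
    then obtain l r where "(l, r) \<in> R" "l' = lift_trm l" "r' = lift_trm r"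
      unfolding lift_rules_def by blast
    then show ?thesis using vars_rhs by simp
  qed
qed

text \<open>Phrased through membership of rules in \<open>U\<close> rather than through
  \<open>depends\<close>: constructors qualify vacuously, and reachability arguments stay confined
  to \<open>usable_rhs\<close> and \<open>usable_part\<close>.\<close>

definition usable_syms :: "'f set" where
  "usable_syms = {f. \<forall>(l, r) \<in> R. root l = Inl f \<longrightarrow> (lift_trm l, lift_trm r) \<in> U}"

lemma undefined_usable: "f \<notin> defined R \<Longrightarrow> f \<in> usable_syms"
  unfolding usable_syms_def defined_def by auto

text \<open>The root of \<open>l\<close> is reachable from a right-hand side of \<open>P\<close>; a
  symbol of \<open>r\<close> that has a rule is one \<open>depends\<close> step further.\<close>

lemma usable_rhs:
  assumes "(l, r) \<in> R" and "(lift_trm l, lift_trm r) \<in> U"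
  shows "funs r \<subseteq> usable_syms"
proof
  fix h assume h: "h \<in> funs r"
  have "(lift_trm l2, lift_trm r2) \<in> U" if lr2: "(l2, r2) \<in> R" "root l2 = Inl h" for l2 r2
  proof -
    obtain lp rp f g where "(lp, rp) \<in> P" "f \<in> funs rp"
      and fg: "(f, g) \<in> (depends (lift_rules R))\<^sup>*" and g: "root (lift_trm l) = Inl g"
      using assms(2) unfolding in_U by blast
    moreover have "(lift_trm l, lift_trm r) \<in> lift_rules R" "(lift_trm l2, lift_trm r2) \<in> lift_rules R"
      using assms(1) lr2(1) unfolding lift_rules_def by blast+
    moreover have root2: "root (lift_trm l2) = Inl (Orig h)"
      using lr2(2) by (simp add: root_lift)
    moreover have "Orig h \<in> defined (lift_rules R)"
      using calculation unfolding defined_def by blast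
    moreover have "Orig h \<in> funs (lift_trm r)"
      using h by (simp add: funs_lift)
    ultimately have "(g, Orig h) \<in> depends (lift_rules R)"
      unfolding depends_def by blast
    with fg have "(f, Orig h) \<in> (depends (lift_rules R))\<^sup>*" by simp
    then show ?thesis
      using \<open>(lp, rp) \<in> P\<close> \<open>f \<in> funs rp\<close> root2 \<open>(lift_trm l2, lift_trm r2) \<in> lift_rules R\<close>
      unfolding in_U by blast
  qed
  then show "h \<in> usable_syms" unfolding usable_syms_def by blast
qed

text \<open>Marking renames only the root. The symbols of the arguments reappear as originals in the
  right-hand side of the pair, where the search for usable rules starts, so reflexivity of the
  closure suffices.\<close>

lemma usable_part:
  assumes "(l, r) \<in> R" and "Fun f ts \<in> set (parts X r)" and "t \<in> set ts"
  shows "funs t \<subseteq> usable_syms"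
proof
  fix h assume "h \<in> funs t"
  then have "Orig h \<in> funs (sharp (Fun f ts) :: (('f, 'c) dpsym, 'v) trm)"
    using assms(3) by (auto simp: funs_lift)
  moreover have "(\<Union>u \<in> set us. funs u) \<subseteq> funs (COM c us)"
    for c and us :: "(('f, 'c) dpsym, 'v) trm list"
    unfolding COM_def by (cases us) auto
  ultimately have "Orig h \<in> funs (COM (\<gamma> (l, r)) (map sharp (parts X r)))"
    using assms(2) by (metis (no_types, lifting) UN_I image_eqI list.set_map subsetD)
  moreover have "(sharp l, COM (\<gamma> (l, r)) (map sharp (parts X r))) \<in> P"
    using assms(1) in_P by blast
  ultimately have "(lift_trm l2, lift_trm r2) \<in> U" if "(l2, r2) \<in> R" "root l2 = Inl h" for l2 r2
    using that unfolding in_U lift_rules_def by (fastforce simp: root_lift)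
  then show "h \<in> usable_syms" unfolding usable_syms_def by blast
qed

section \<open>Transfer of redexes, normal forms and steps for unmarked terms\<close>

lemma lift_redex:
  assumes "funs (plug C (l \<cdot> \<sigma>)) \<subseteq> usable_syms" and "(l, r) \<in> R"
  shows "(lift_trm l, lift_trm r) \<in> U" and "funs (plug C (r \<cdot> \<sigma>)) \<subseteq> usable_syms"
proof -
  obtain f ls where "l = Fun f ls" using lhs_Fun assms(2) by blast
  \<comment> \<open>The root of a left-hand side survives instantiation and so is a symbol of the
    whole term.\<close>
  moreover from this assms(1) have "f \<in> usable_syms"
    by (auto simp: funs_plug)
  ultimately show U: "(lift_trm l, lift_trm r) \<in> U"
    using assms(2) unfolding usable_syms_def by auto
  \<comment> \<open>Symbols of the contractum come from the context, from \<open>r\<close> itself,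
    or from values of \<open>\<sigma>\<close> that already occur in the redex.\<close>
  show "funs (plug C (r \<cdot> \<sigma>)) \<subseteq> usable_syms"
    using assms(1) usable_rhs[OF assms(2) U] vars_rhs[OF assms(2)]
    unfolding funs_plug funs_subst by blast
qed

text \<open>A lifted term contains no marked symbol, so no pair applies inside it and the rule must
  be a lifted rule of \<open>R\<close>. Junk that arises from translating \<open>\<tau>\<close> back
  can lie only outside the variables of \<open>l\<close>, and \<open>r\<close> introduces none of
  those.\<close>

lemma unlift_redex:
  assumes "lift_trm s = plug D (l' \<cdot> \<tau>)" and "(l', r') \<in> P \<union> U"
  obtains C l r \<sigma> where "(l, r) \<in> R" "s = plug C (l \<cdot> \<sigma>)"
    "plug D (r' \<cdot> \<tau>) = lift_trm (plug C (r \<cdot> \<sigma>))" "l' \<cdot> \<tau> = lift_trm (l \<cdot> \<sigma>)"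
proof -
  have Orig: "set1_ctxt D \<union> funs (l' \<cdot> \<tau>) \<subseteq> range Orig"
    using arg_cong[OF assms(1), of funs] by (auto simp: funs_lift funs_plug)
  have "(l', r') \<notin> P"
  proof
    assume "(l', r') \<in> P"
    then obtain f ls where "l' = sharp (Fun f ls)" using in_P lhs_Fun by blast
    with Orig show False by auto
  qed
  with assms(2) have "(l', r') \<in> lift_rules R" using in_U by blast
  then obtain l r where lr: "(l, r) \<in> R" "l' = lift_trm l" "r' = lift_trm r"
    unfolding lift_rules_def by blast
  define C where "C = map_ctxt (\<lambda>g :: ('f, 'c) dpsym. case g of Orig f \<Rightarrow> f | _ \<Rightarrow> undefined) id D"
  define \<sigma> where "\<sigma> = (\<lambda>x. unlift_trm (\<tau> x))"
  have unlift: "unlift_trm (plug D (lift_trm t \<cdot> \<tau>)) = plug C (t \<cdot> \<sigma>)" for t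
    unfolding C_def \<sigma>_def by (metis map_trm_plug unlift_trm_def unlift_subst unlift_lift)
  have "s = plug C (l \<cdot> \<sigma>)"
    using arg_cong[OF assms(1), of unlift_trm] lr unlift by simp
  moreover have "funs (r' \<cdot> \<tau>) \<subseteq> range Orig"
    using Orig vars_rhs[OF lr(1)] unfolding lr funs_subst funs_lift vars_lift by blast
  then have "plug D (r' \<cdot> \<tau>) = lift_trm (plug C (r \<cdot> \<sigma>))"
    using Orig unlift[of r] lr by (metis Un_subset_iff funs_plug lift_unlift)
  moreover have "l' \<cdot> \<tau> = lift_trm (l \<cdot> \<sigma>)"
    using Orig unfolding lr \<sigma>_def by (metis Un_subset_iff lift_unlift unlift_lift unlift_subst)
  ultimately show thesis using that lr(1) by blast
qed

text \<open>Usability of all symbols guarantees that the rule behind every \<open>R\<close>-redex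
  has its lift in \<open>U\<close>; conversely, only lifted rules can act on a lifted term.\<close>

lemma normal_form_lift:
  assumes "funs s \<subseteq> usable_syms"
  shows "normal_form (P \<union> U) (lift_trm s) \<longleftrightarrow> normal_form R s"
proof -
  have "\<exists>t. (lift_trm s, t) \<in> rstep (P \<union> U)" if "(s, s') \<in> rstep R" for s'
  proof -
    obtain C l r \<sigma> where s: "s = plug C (l \<cdot> \<sigma>)" "(l, r) \<in> R"
      using \<open>(s, s') \<in> rstep R\<close> unfolding rstep_def by blast
    then have "(lift_trm l, lift_trm r) \<in> P \<union> U"
      using lift_redex assms by blast
    moreover have "lift_trm s = plug (map_ctxt Orig id C) (lift_trm l \<cdot> (\<lambda>x. lift_trm (\<sigma> x)))"
      by (simp add: s map_trm_plug map_trm_subst)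
    ultimately show ?thesis unfolding rstep_def by blast
  qed
  moreover have "\<exists>s'. (s, s') \<in> rstep R" if step: "(lift_trm s, t) \<in> rstep (P \<union> U)" for t
  proof -
    obtain D l' r' \<tau> where "lift_trm s = plug D (l' \<cdot> \<tau>)" "(l', r') \<in> P \<union> U"
      using step unfolding rstep_def by blast
    then obtain C l r \<sigma> where "(l, r) \<in> R" "s = plug C (l \<cdot> \<sigma>)"
      by (rule unlift_redex)
    then show ?thesis unfolding rstep_def by blast
  qed
  ultimately show ?thesis unfolding normal_form_def by blast
qed

text \<open>The roots \<open>g\<close> and \<open>f\<close> are independent because only proper
  subterms matter; this covers a marked root, with \<open>g = Sharp f\<close>, as well as an
  unmarked one.\<close>

lemma args_normal_lift:
  assumes "\<And>t. t \<in> set ts \<Longrightarrow> funs t \<subseteq> usable_syms"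
  shows "args_normal (P \<union> U) (Fun g (map lift_trm ts)) \<longleftrightarrow> args_normal R (Fun f ts)"
proof -
  have "(\<forall>D w. lift_trm t = plug D w \<longrightarrow> normal_form (P \<union> U) w) \<longleftrightarrow>
      (\<forall>C u. t = plug C u \<longrightarrow> normal_form R u)" if t: "t \<in> set ts" for t
  proof (intro iffI allI impI)
    fix C u assume *: "\<forall>D w. lift_trm t = plug D w \<longrightarrow> normal_form (P \<union> U) w" and "t = plug C u"
    then show "normal_form R u"
      using assms[OF t] normal_form_lift[of u] by (simp add: funs_plug map_trm_plug)
  next
    fix D and w :: "(('f, 'c) dpsym, 'v) trm"
    assume *: "\<forall>C u. t = plug C u \<longrightarrow> normal_form R u" and w: "lift_trm t = plug D w"
    then have "t = plug (map_ctxt (\<lambda>g. case g of Orig f \<Rightarrow> f | _ \<Rightarrow> undefined) id D) (unlift_trm w)"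
      by (metis map_trm_plug unlift_trm_def unlift_lift)
    then have "normal_form R (unlift_trm w)" "funs (unlift_trm w) \<subseteq> usable_syms"
      using * assms[OF t] by (blast, simp add: funs_plug)
    moreover have "lift_trm (unlift_trm w) = w"
      using arg_cong[OF w, of funs] by (intro lift_unlift) (auto simp: funs_plug funs_lift)
    ultimately show "normal_form (P \<union> U) w" using normal_form_lift by metis
  qed
  then show ?thesis by (simp add: args_normal_Fun)
qed

lemma args_normal_lift_trm:
  assumes "funs s \<subseteq> usable_syms"
  shows "args_normal (P \<union> U) (lift_trm s) \<longleftrightarrow> args_normal R s"
proof (cases s)
  case (Var x)
  then show ?thesis
    by (simp add: args_normal_def not_proper_subterm_Var)
next
  case (Fun f ts)
  then show ?thesis using assms args_normal_lift[of ts "Orig f" f] by (auto simp: UN_subset_iff)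
qed

lemma step_lift:
  assumes closed: "funs s \<subseteq> usable_syms" and "(s, s') \<in> step_of inn R"
  shows "(lift_trm s, lift_trm s') \<in> step_of inn (P \<union> U)" and "funs s' \<subseteq> usable_syms"
proof -
  obtain C l r \<sigma> where s: "s = plug C (l \<cdot> \<sigma>)" "s' = plug C (r \<cdot> \<sigma>)" "(l, r) \<in> R"
    "inn \<longrightarrow> args_normal R (l \<cdot> \<sigma>)"
    using assms unfolding step_of_def by blast
  show "funs s' \<subseteq> usable_syms" using lift_redex(2) closed s by blast
  have lift: "lift_trm (plug C (t \<cdot> \<sigma>)) = plug (map_ctxt Orig id C) (lift_trm t \<cdot> (\<lambda>x. lift_trm (\<sigma> x)))"
    for t by (simp add: map_trm_plug map_trm_subst)
  have "inn \<longrightarrow> args_normal (P \<union> U) (lift_trm l \<cdot> (\<lambda>x. lift_trm (\<sigma> x)))"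
    using s(4) closed args_normal_lift_trm[of "l \<cdot> \<sigma>"]
    unfolding s(1) map_trm_subst[symmetric] funs_plug by blast
  moreover have "(lift_trm l, lift_trm r) \<in> P \<union> U"
    using lift_redex(1) closed s by blast
  ultimately show "(lift_trm s, lift_trm s') \<in> step_of inn (P \<union> U)"
    unfolding step_of_def s(1,2) lift by blast
qed

lemma step_unlift:
  assumes closed: "funs s \<subseteq> usable_syms" and "(lift_trm s, w) \<in> step_of inn (P \<union> U)"
  obtains s' where "w = lift_trm s'" "(s, s') \<in> step_of inn R"
proof -
  obtain D l' r' \<tau> where w: "lift_trm s = plug D (l' \<cdot> \<tau>)" "w = plug D (r' \<cdot> \<tau>)"
    "(l', r') \<in> P \<union> U" "inn \<longrightarrow> args_normal (P \<union> U) (l' \<cdot> \<tau>)"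
    using assms unfolding step_of_def by blast
  from w(1,3) obtain C l r \<sigma> where s: "(l, r) \<in> R" "s = plug C (l \<cdot> \<sigma>)"
    "plug D (r' \<cdot> \<tau>) = lift_trm (plug C (r \<cdot> \<sigma>))" "l' \<cdot> \<tau> = lift_trm (l \<cdot> \<sigma>)"
    by (rule unlift_redex)
  have "inn \<longrightarrow> args_normal R (l \<cdot> \<sigma>)"
    using w(4) closed args_normal_lift_trm[of "l \<cdot> \<sigma>"]
    unfolding s(2,4) funs_plug by blast
  then have "(s, plug C (r \<cdot> \<sigma>)) \<in> step_of inn R"
    unfolding step_of_def using s by blast
  then show thesis using that w(2) s(3) by metis
qed

lemma list_step_lift:
  assumes "\<forall>t \<in> set ts. funs t \<subseteq> usable_syms" and "(ts, ts') \<in> list_step (step_of inn R)"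
  shows "(map lift_trm ts, map lift_trm ts') \<in> list_step (step_of inn (P \<union> U))"
    and "\<forall>t \<in> set ts'. funs t \<subseteq> usable_syms"
proof -
  from assms(2) obtain as s s' bs where ts: "ts = as @ s # bs" "ts' = as @ s' # bs"
    and step: "(s, s') \<in> step_of inn R"
    unfolding list_step_def by blast
  have s: "funs s \<subseteq> usable_syms" using assms(1) ts(1) by simp
  show "(map lift_trm ts, map lift_trm ts') \<in> list_step (step_of inn (P \<union> U))"
    unfolding list_step_def ts list.map map_append using step_lift(1)[OF s step] by blast
  show "\<forall>t \<in> set ts'. funs t \<subseteq> usable_syms"
    using step_lift(2)[OF s step] assms(1) unfolding ts by simp
qed

lemma list_step_unlift:
  assumes "\<forall>t \<in> set ts. funs t \<subseteq> usable_syms"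
    and "(map lift_trm ts, ws) \<in> list_step (step_of inn (P \<union> U))"
  shows "\<exists>ts'. ws = map lift_trm ts' \<and> (ts, ts') \<in> list_step (step_of inn R)"
  using assms
proof (induction ts arbitrary: ws)
  case Nil
  then show ?case by (simp add: list_step_Nil)
next
  case (Cons t ts)
  from Cons.prems(2) consider
      (head) w where "ws = w # map lift_trm ts" "(lift_trm t, w) \<in> step_of inn (P \<union> U)"
    | (tail) ws' where "ws = lift_trm t # ws'" "(map lift_trm ts, ws') \<in> list_step (step_of inn (P \<union> U))"
    unfolding list.map list_step_Cons by blast
  then show ?case
  proof cases
    case head
    with Cons.prems obtain t' where "w = lift_trm t'" "(t, t') \<in> step_of inn R"
      by (auto elim: step_unlift)
    with head have "ws = map lift_trm (t' # ts)" "(t # ts, t' # ts) \<in> list_step (step_of inn R)"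
      by (auto simp: list_step_Cons)
    then show ?thesis by blast
  next
    case tail
    with Cons.IH[of ws'] Cons.prems(1)
    obtain ts' where "ws' = map lift_trm ts'" "(ts, ts') \<in> list_step (step_of inn R)"
      by (auto simp: id_def)
    with tail have "ws = map lift_trm (t # ts')" "(t # ts, t # ts') \<in> list_step (step_of inn R)"
      by (auto simp: list_step_Cons)
    then show ?thesis by blast
  qed
qed

section \<open>Matching a term with its list of pieces\<close>

text \<open>The second argument is a list because the pieces below a nested context are the arguments of
  one flat compound symbol.\<close>

inductive matches :: "('f, 'v) trm \<Rightarrow> (('f, 'c) dpsym, 'v) trm list \<Rightarrow> bool"
  and matches_list :: "('f, 'v) trm list \<Rightarrow> (('f, 'c) dpsym, 'v) trm list \<Rightarrow> bool" where
  unmarked: "funs s \<subseteq> usable_syms \<Longrightarrow> matches s [lift_trm s]"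
| marked: "\<forall>t \<in> set ts. funs t \<subseteq> usable_syms \<Longrightarrow>
    matches (Fun f ts) [Fun (Sharp f) (map lift_trm ts)]"
| compound: "matches s ws \<Longrightarrow> matches s [Fun (Com c n) ws]"
| normal: "normal_form R s \<Longrightarrow> matches s []"
| constructor: "f \<notin> defined R \<Longrightarrow> matches_list ts ws \<Longrightarrow> matches (Fun f ts) ws"
| Nil: "matches_list [] []"
| Cons: "matches t us \<Longrightarrow> matches_list ts ws \<Longrightarrow> matches_list (t # ts) (us @ ws)"

text \<open>The cases of \<open>parts\<close> mirror the rules of \<open>matches\<close>. A symbol
  in \<open>X\<close> gives a marked piece, and a symbol outside it a constructor above further
  pieces. A variable gives an unmarked piece in full rewriting and a dropped normal form in
  innermost rewriting.\<close>

lemma matches_parts: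
  assumes "\<And>x. inn \<Longrightarrow> x \<in> vars r \<Longrightarrow> normal_form R (\<sigma> x)"
    and "\<And>x. x \<in> vars r \<Longrightarrow> funs (\<sigma> x) \<subseteq> usable_syms"
    and "\<And>f ts t. Fun f ts \<in> set (parts X r) \<Longrightarrow> t \<in> set ts \<Longrightarrow> funs t \<subseteq> usable_syms"
    and \<tau>: "\<And>x. \<tau> x = lift_trm (\<sigma> x)"
  shows "matches (r \<cdot> \<sigma>) (map (\<lambda>u. sharp u \<cdot> \<tau>) (parts X r))"
  using assms(1-3)
proof (induction r)
  case (Var x)
  show ?case
  proof (cases inn)
    case True
    with Var.prems(1) have "normal_form R (\<sigma> x)" by simp
    moreover have "Inr x \<notin> X" using True unfolding X_def by auto
    ultimately show ?thesis by (simp add: matches_matches_list.normal)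
  next
    case False
    then have "Inr x \<in> X" unfolding X_def by auto
    then show ?thesis
      using matches_matches_list.unmarked[of "\<sigma> x"] Var.prems(2) by (simp add: \<tau>)
  qed
next
  case (Fun f ts)
  show ?case
  proof (cases "Inl f \<in> X")
    case True
    have "\<forall>t \<in> set (map (\<lambda>t. t \<cdot> \<sigma>) ts). funs t \<subseteq> usable_syms"
    proof
      fix t' assume "t' \<in> set (map (\<lambda>t. t \<cdot> \<sigma>) ts)"
      then obtain t where "t' = t \<cdot> \<sigma>" and t: "t \<in> set ts" by auto
      moreover have "funs t \<subseteq> usable_syms" using Fun.prems(3) True t by simp
      moreover have "\<forall>x \<in> vars t. funs (\<sigma> x) \<subseteq> usable_syms" using Fun.prems(2) t by auto
      ultimately show "funs t' \<subseteq> usable_syms" by (auto simp: funs_subst)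
    qed
    moreover have "lift_trm (t \<cdot> \<sigma>) = lift_trm t \<cdot> \<tau>" for t
      unfolding map_trm_subst using \<tau> by (intro subst_cong) simp
    ultimately show ?thesis
      using matches_matches_list.marked[of "map (\<lambda>t. t \<cdot> \<sigma>) ts" f] True by (simp add: comp_def)
  next
    case False
    have "matches_list (map (\<lambda>t. t \<cdot> \<sigma>) us)
        (map (\<lambda>u. sharp u \<cdot> \<tau>) (concat (map (parts X) us)))"
      if "set us \<subseteq> set ts" for us
      using that
    proof (induction us)
      case Nil
      then show ?case by (simp add: matches_matches_list.Nil)
    next
      case (Cons u us)
      then have u: "u \<in> set ts" by simp
      have "matches (u \<cdot> \<sigma>) (map (\<lambda>u. sharp u \<cdot> \<tau>) (parts X u))"
      proof (rule Fun.IH[OF u])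
        show "normal_form R (\<sigma> x)" if "inn" "x \<in> vars u" for x
          using Fun.prems(1) that u by auto
        show "funs (\<sigma> x) \<subseteq> usable_syms" if "x \<in> vars u" for x
          using Fun.prems(2) that u by auto
        show "funs t \<subseteq> usable_syms" if "Fun g ss \<in> set (parts X u)" "t \<in> set ss" for g ss t
          using Fun.prems(3)[of g ss t] that u False by auto
      qed
      with Cons show ?case by (simp add: matches_matches_list.Cons)
    qed
    moreover have "f \<notin> defined R" using False unfolding X_def by auto
    ultimately show ?thesis
      using False by (auto intro: matches_matches_list.constructor)
  qed
qed

text \<open>For exactly one part \<open>COM\<close> adds no symbol; for any other number, including
  zero, the parts are gathered below one compound symbol.\<close>

lemma matches_COM:
  assumes "matches s (map (\<lambda>w. w \<cdot> \<tau>) ws)"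
  shows "matches s [COM c ws \<cdot> \<tau>]"
proof (cases "length ws = 1")
  case True
  then obtain w where "ws = [w]" by (auto simp: length_Suc_conv)
  with assms show ?thesis by (simp add: COM_def)
next
  case False
  with assms show ?thesis by (simp add: COM_def matches_matches_list.compound)
qed

text \<open>Shared by both simulation directions: after a root step of a marked piece, the reduct
  and the right-hand side of the pair correspond again.\<close>

lemma matches_pair:
  assumes "(l, r) \<in> R" and "l \<cdot> \<sigma> = Fun f ts" and "\<forall>t \<in> set ts. funs t \<subseteq> usable_syms"
    and "inn \<longrightarrow> args_normal R (Fun f ts)"
  shows "matches (r \<cdot> \<sigma>)
    [COM c (map sharp (parts X r)) \<cdot> (\<lambda>x. lift_trm (\<sigma> x))]"
proof -
  obtain ls where l: "l = Fun f ls" and ts: "ts = map (\<lambda>t. t \<cdot> \<sigma>) ls"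
    using lhs_Fun[OF assms(1)] assms(2) by auto
  have "matches (r \<cdot> \<sigma>) (map (\<lambda>u. sharp u \<cdot> (\<lambda>x. lift_trm (\<sigma> x))) (parts X r))"
  proof (rule matches_parts)
    show "normal_form R (\<sigma> x)" if "inn" "x \<in> vars r" for x
      using args_normal_var[of R f ls \<sigma> x] assms(2,4) vars_rhs[OF assms(1)] that l by auto
    show "funs (\<sigma> x) \<subseteq> usable_syms" if x: "x \<in> vars r" for x
    proof -
      from x vars_rhs[OF assms(1)] l obtain t where "t \<in> set ls" "x \<in> vars t" by auto
      with assms(3) ts show ?thesis by (auto simp: funs_subst)
    qed
  qed (use usable_part[OF assms(1)] in blast, rule refl)
  then show ?thesis by (intro matches_COM) (simp add: comp_def)
qed

text \<open>A root step of a marked piece is answered by its pair, every other step by a usable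
  rule. Compound symbols only pass steps on, so one step always answers one step and lengths are
  preserved exactly.\<close>

lemma simulates:
  "matches s ws \<Longrightarrow> (s, s') \<in> step_of inn R \<Longrightarrow>
    \<exists>ws'. (ws, ws') \<in> list_step (step_of inn (P \<union> U)) \<and> matches s' ws'"
  and simulates_list:
  "matches_list ts ws \<Longrightarrow> (ts, ts') \<in> list_step (step_of inn R) \<Longrightarrow>
    \<exists>ws'. (ws, ws') \<in> list_step (step_of inn (P \<union> U)) \<and> matches_list ts' ws'"
proof (induction arbitrary: s' and ts' rule: matches_matches_list.inducts)
  case (unmarked s)
  then have "(lift_trm s, lift_trm s') \<in> step_of inn (P \<union> U)" "funs s' \<subseteq> usable_syms"
    using step_lift by blast+
  then show ?case using matches_matches_list.unmarked by (auto simp: list_step_singleton)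
next
  case (marked ts f)
  from marked.prems show ?case
  proof (cases rule: step_of_FunE)
    case (root l r \<sigma>)
    obtain ls where l: "l = Fun f ls" and ts: "ts = map (\<lambda>t. t \<cdot> \<sigma>) ls"
      using lhs_Fun[OF root(1)] root(2) by auto
    let ?l = "sharp l \<cdot> (\<lambda>x. lift_trm (\<sigma> x))"
    let ?r = "COM (\<gamma> (l, r)) (map sharp (parts X r)) \<cdot> (\<lambda>x. lift_trm (\<sigma> x))"
    have redex: "?l = Fun (Sharp f) (map lift_trm ts)"
      by (simp add: l ts map_trm_subst)
    have "(?l, ?r) \<in> step_of inn (P \<union> U)"
    proof (rule step_of_root)
      show "(sharp l, COM (\<gamma> (l, r)) (map sharp (parts X r))) \<in> P \<union> U"
        using in_P root(1) by blast
      show "args_normal (P \<union> U) ?l" if inn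
        unfolding redex using marked(1) root(4) that args_normal_lift by blast
    qed
    moreover have "matches s' [?r]"
      unfolding root(3) by (rule matches_pair[OF root(1) root(2)[symmetric] marked(1) root(4)])
    ultimately show ?thesis unfolding redex by (auto simp: list_step_singleton)
  next
    case (args ts')
    then have "(map lift_trm ts, map lift_trm ts') \<in> list_step (step_of inn (P \<union> U))"
      "\<forall>t \<in> set ts'. funs t \<subseteq> usable_syms"
      using list_step_lift marked(1) by blast+
    then show ?thesis
      using step_of_args matches_matches_list.marked args(1) by (fastforce simp: list_step_singleton)
  qed
next
  case (compound s ws c n)
  then obtain ws' where "(ws, ws') \<in> list_step (step_of inn (P \<union> U))" "matches s' ws'"
    by blast
  then show ?case
    using step_of_args matches_matches_list.compound by (fastforce simp: list_step_singleton)
next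
  case (normal s)
  then show ?case using step_of_subset_rstep unfolding normal_form_def by blast
next
  case (constructor f ts ws)
  from constructor.prems show ?case
  proof (cases rule: step_of_FunE)
    case (root l r \<sigma>)
    then have "f \<in> defined R"
      using lhs_Fun[OF root(1)] unfolding defined_def by force
    with constructor show ?thesis by blast
  next
    case (args ts')
    with constructor.IH matches_matches_list.constructor[OF \<open>f \<notin> defined R\<close>] show ?thesis
      by blast
  qed
next
  case Nil
  then show ?case by (simp add: list_step_Nil)
next
  case (Cons t us ts ws)
  from Cons.prems consider
      (head) t' where "ts' = t' # ts" "(t, t') \<in> step_of inn R"
    | (tail) ts'' where "ts' = t # ts''" "(ts, ts'') \<in> list_step (step_of inn R)"
    by (auto simp: list_step_Cons)
  then show ?case
  proof cases
    case head
    with Cons.IH obtain us' where "(us, us') \<in> list_step (step_of inn (P \<union> U))" "matches t' us'"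
      by blast
    with matches_matches_list.Cons[OF _ \<open>matches_list ts ws\<close>] head(1)
    have "matches_list ts' (us' @ ws)" "(us @ ws, us' @ ws) \<in> list_step (step_of inn (P \<union> U))"
      by (simp_all add: list_step_append)
    then show ?thesis by blast
  next
    case tail
    with Cons.IH obtain ws' where "(ws, ws') \<in> list_step (step_of inn (P \<union> U))"
      "matches_list ts'' ws'"
      by blast
    with matches_matches_list.Cons[OF \<open>matches t us\<close>] tail(1)
    have "matches_list ts' (us @ ws')" "(us @ ws, us @ ws') \<in> list_step (step_of inn (P \<union> U))"
      by (simp_all add: list_step_append)
    then show ?thesis by blast
  qed
qed

text \<open>No left-hand side starts with a compound symbol, and marked roots belong to pairs only.
  This decides which rules can act at the root of a piece.\<close>

lemma root_lhs:
  assumes "(l', r') \<in> P \<union> U"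
  obtains f ls where "l' = Fun (Sharp f) ls" "(l', r') \<in> P" | f ls where "l' = Fun (Orig f) ls"
proof -
  consider "(l', r') \<in> P" | "(l', r') \<in> lift_rules R" using assms in_U by blast
  then show thesis
  proof cases
    case 1
    then obtain f ls where "l' = sharp (Fun f ls)" using in_P lhs_Fun by blast
    then show thesis using 1 that by simp
  next
    case 2
    then obtain f ls where "l' = lift_trm (Fun f ls)" using lhs_Fun unfolding lift_rules_def by blast
    then show thesis using that by simp
  qed
qed

text \<open>The converse direction, which prevents the extended system from having derivations of
  additional lengths.\<close>

lemma simulated:
  "matches s ws \<Longrightarrow> (ws, ws') \<in> list_step (step_of inn (P \<union> U)) \<Longrightarrow>
    \<exists>s'. (s, s') \<in> step_of inn R \<and> matches s' ws'"
  and simulated_list: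
  "matches_list ts ws \<Longrightarrow> (ws, ws') \<in> list_step (step_of inn (P \<union> U)) \<Longrightarrow>
    \<exists>ts'. (ts, ts') \<in> list_step (step_of inn R) \<and> matches_list ts' ws'"
proof (induction arbitrary: ws' and ws' rule: matches_matches_list.inducts)
  case (unmarked s)
  then obtain w where w: "ws' = [w]" "(lift_trm s, w) \<in> step_of inn (P \<union> U)"
    by (auto simp: list_step_singleton)
  with unmarked obtain s' where "w = lift_trm s'" "(s, s') \<in> step_of inn R"
    by (auto elim: step_unlift)
  moreover from this have "funs s' \<subseteq> usable_syms" using step_lift unmarked(1) by blast
  ultimately show ?case using w(1) matches_matches_list.unmarked by blast
next
  case (marked ts f)
  then obtain w where w: "ws' = [w]"
    "(Fun (Sharp f) (map lift_trm ts), w) \<in> step_of inn (P \<union> U)"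
    by (auto simp: list_step_singleton)
  from w(2) show ?case
  proof (cases rule: step_of_FunE)
    case (root l' r' \<tau>)
    have "(l', r') \<in> P" by (rule root_lhs[OF root(1)]) (use root(2) in auto)
    then obtain l r where lr: "(l, r) \<in> R" "l' = sharp l"
      "r' = COM (\<gamma> (l, r)) (map sharp (parts X r))"
      using in_P by blast
    then obtain g ls where l: "l = Fun g ls" using lhs_Fun by blast
    then have g: "g = f" using root(2) lr(2) by simp
    have "lift_trm l \<cdot> \<tau> = lift_trm (Fun f ts)"
      using root(2) unfolding lr l g by simp
    \<comment> \<open>The matcher \<open>\<tau>\<close> lives over the extended signature. Its
      translation back matches \<open>l\<close>, and on the variables of the pair lifting it again
      recovers \<open>\<tau>\<close>.\<close>
    define \<sigma> where "\<sigma> = (\<lambda>x. unlift_trm (\<tau> x))"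
    have l_eq: "l \<cdot> \<sigma> = Fun f ts"
      using arg_cong[OF \<open>lift_trm l \<cdot> \<tau> = lift_trm (Fun f ts)\<close>, of unlift_trm]
      unfolding \<sigma>_def unlift_subst unlift_lift .
    have "vars r' \<subseteq> vars l"
      using vars_extended_rhs[OF root(1)] unfolding lr(2) vars_sharp .
    then have r_eq: "r' \<cdot> \<tau> = r' \<cdot> (\<lambda>x. lift_trm (\<sigma> x))"
      unfolding \<sigma>_def by (rule lift_subst_cong[OF \<open>lift_trm l \<cdot> \<tau> = lift_trm (Fun f ts)\<close>])
    have normal: "inn \<longrightarrow> args_normal R (Fun f ts)"
      using root(4) args_normal_lift marked(1) by blast
    have "(l \<cdot> \<sigma>, r \<cdot> \<sigma>) \<in> step_of inn R"
      using lr(1) normal unfolding l_eq[symmetric] by (auto intro: step_of_root)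
    moreover have "matches (r \<cdot> \<sigma>) [r' \<cdot> \<tau>]"
      unfolding r_eq unfolding lr(3) by (rule matches_pair[OF lr(1) l_eq marked(1) normal])
    ultimately show ?thesis unfolding w(1) root(3) l_eq by blast
  next
    case (args us)
    then obtain ts' where "us = map lift_trm ts'" "(ts, ts') \<in> list_step (step_of inn R)"
      using list_step_unlift marked(1) by blast
    moreover from this have "\<forall>t \<in> set ts'. funs t \<subseteq> usable_syms"
      using list_step_lift marked(1) by blast
    ultimately show ?thesis
      using w(1) args(1) step_of_args matches_matches_list.marked by fast
  qed
next
  case (compound s ws c n)
  then obtain w where w: "ws' = [w]" "(Fun (Com c n) ws, w) \<in> step_of inn (P \<union> U)"
    by (auto simp: list_step_singleton)
  from w(2) show ?case
  proof (cases rule: step_of_FunE)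
    case (root l' r' \<tau>)
    from root(1) show ?thesis by (rule root_lhs) (use root(2) in auto)
  next
    case (args us)
    with compound.IH obtain s' where "(s, s') \<in> step_of inn R" "matches s' us" by blast
    then show ?thesis using w(1) args(1) matches_matches_list.compound by blast
  qed
next
  case (normal s)
  then show ?case by (simp add: list_step_Nil)
next
  case (constructor f ts ws)
  then obtain ts' where "(ts, ts') \<in> list_step (step_of inn R)" "matches_list ts' ws'" by blast
  with matches_matches_list.constructor[OF \<open>f \<notin> defined R\<close>]
  have "matches (Fun f ts') ws'" "(Fun f ts, Fun f ts') \<in> step_of inn R"
    by (simp_all add: step_of_args)
  then show ?case by blast
next
  case Nil
  then show ?case by (simp add: list_step_Nil)
next
  case (Cons t us ts ws)
  from Cons.prems consider
      (head) us' where "ws' = us' @ ws" "(us, us') \<in> list_step (step_of inn (P \<union> U))"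
    | (tail) ws'' where "ws' = us @ ws''" "(ws, ws'') \<in> list_step (step_of inn (P \<union> U))"
    by (auto simp: list_step_append)
  then show ?case
  proof cases
    case head
    with Cons.IH obtain t' where "(t, t') \<in> step_of inn R" "matches t' us'" by blast
    with matches_matches_list.Cons[OF _ \<open>matches_list ts ws\<close>] head(1)
    have "matches_list (t' # ts) ws'" "(t # ts, t' # ts) \<in> list_step (step_of inn R)"
      by (simp_all add: list_step_Cons)
    then show ?thesis by blast
  next
    case tail
    with Cons.IH obtain ts' where "(ts, ts') \<in> list_step (step_of inn R)"
      "matches_list ts' ws''" by blast
    with matches_matches_list.Cons[OF \<open>matches t us\<close>] tail(1)
    have "matches_list (t # ts') ws'" "(t # ts, t # ts') \<in> list_step (step_of inn R)"
      by (simp_all add: list_step_Cons)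
    then show ?thesis by blast
  qed
qed

text \<open>The arguments of a basic term contain no defined symbol, so they satisfy the invariant
  vacuously, and the defined root carries the mark.\<close>

lemma matches_basic:
  assumes "t \<in> basic_terms F ar R"
  shows "matches t [sharp t]"
proof -
  obtain f ts where t: "t = Fun f ts" "set ts \<subseteq> terms_over (F - defined R) ar"
    using assms unfolding basic_terms_def by blast
  have "funs s \<subseteq> A" if "wf_trm A ar s" for s :: "('f, 'v) trm" and A
    using that by (induction s) auto
  then have "\<forall>s \<in> set ts. funs s \<subseteq> F - defined R"
    using t(2) unfolding terms_over_def by blast
  then have "\<forall>s \<in> set ts. funs s \<subseteq> usable_syms"
    using undefined_usable by blast
  from matches_matches_list.marked[OF this, of f] show ?thesis by (simp add: t(1))
qed

end

subsection \<open>Derivation heights\<close>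

definition bisimulation :: "('a \<Rightarrow> 'b \<Rightarrow> bool) \<Rightarrow> 'a rel \<Rightarrow> 'b rel \<Rightarrow> bool" where
  "bisimulation B r q \<longleftrightarrow>
    (\<forall>s t s'. B s t \<longrightarrow> (s, s') \<in> r \<longrightarrow> (\<exists>t'. (t, t') \<in> q \<and> B s' t')) \<and>
    (\<forall>s t t'. B s t \<longrightarrow> (t, t') \<in> q \<longrightarrow> (\<exists>s'. (s, s') \<in> r \<and> B s' t'))"

lemma bisimulation_sym: "bisimulation B r q \<Longrightarrow> bisimulation (\<lambda>t s. B s t) q r"
  unfolding bisimulation_def by blast

lemma bisimulation_relpow:
  assumes "bisimulation B r q" and "B s t" and "(s, s') \<in> r ^^ n"
  shows "\<exists>t'. (t, t') \<in> q ^^ n \<and> B s' t'"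
  using assms(3)
proof (induction n arbitrary: s')
  case 0
  with assms(2) show ?case by simp
next
  case (Suc n)
  then obtain u where "(s, u) \<in> r ^^ n" "(u, s') \<in> r" by auto
  with Suc.IH obtain t' where t': "(t, t') \<in> q ^^ n" "B u t'" by blast
  with assms(1) \<open>(u, s') \<in> r\<close> obtain t'' where "(t', t'') \<in> q" "B s' t''"
    unfolding bisimulation_def by blast
  with t' show ?case by auto
qed

text \<open>Related elements admit derivations of the same lengths, so both heights are the maximum
  of one and the same set.\<close>

lemma bisimulation_dh:
  assumes "bisimulation B r q" and "B s t"
  shows "dh s r = dh t q"
proof -
  have "(\<exists>s'. (s, s') \<in> r ^^ n) \<longleftrightarrow> (\<exists>t'. (t, t') \<in> q ^^ n)" for n
    by (blast dest: bisimulation_relpow[OF assms]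
        bisimulation_relpow[OF bisimulation_sym[OF assms(1)] assms(2)])
  then show ?thesis unfolding dh_def by simp
qed

lemma bisimulation_terminating_on:
  assumes "bisimulation B r q" and "B s t" and "terminating_on r s"
  shows "terminating_on q t"
  unfolding terminating_on_def
proof
  assume "\<exists>a. a 0 = t \<and> (\<forall>i. (a i, a (Suc i)) \<in> q)"
  then obtain a where a: "a 0 = t" "\<And>i. (a i, a (Suc i)) \<in> q" by blast
  \<comment> \<open>An infinite \<open>q\<close>-sequence is traced in \<open>r\<close> by dependent
    choice. The conjunct for \<open>i = 0\<close> pins the start to \<open>s\<close>; otherwise any
    element related to \<open>a 0\<close> could be chosen.\<close>
  have "\<exists>b. \<forall>i. (B (b i) (a i) \<and> (i = 0 \<longrightarrow> b i = s)) \<and> (b i, b (Suc i)) \<in> r"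
  proof (rule dependent_nat_choice[where P = "\<lambda>i x. B x (a i) \<and> (i = 0 \<longrightarrow> x = s)"
        and Q = "\<lambda>_ x y. (x, y) \<in> r"])
    show "\<exists>x. B x (a 0) \<and> (0 = (0 :: nat) \<longrightarrow> x = s)" using assms(2) a(1) by auto
    show "\<exists>y. (B y (a (Suc i)) \<and> (Suc i = 0 \<longrightarrow> y = s)) \<and> (x, y) \<in> r"
      if "B x (a i) \<and> (i = 0 \<longrightarrow> x = s)" for x i
      using assms(1) a(2)[of i] that unfolding bisimulation_def by blast
  qed
  with assms(3) show False unfolding terminating_on_def by blast
qed

context weak_pairs_of_trs
begin

text \<open>A step from a one-element list leads to a one-element list, so the simulation of lists
  restricts to single extended terms.\<close>

lemma bisimulation_matches:
  "bisimulation (\<lambda>s w. matches s [w]) (step_of inn R) (step_of inn (P \<union> U))"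
  unfolding bisimulation_def
proof (intro conjI allI impI)
  show "\<exists>w'. (w, w') \<in> step_of inn (P \<union> U) \<and> matches s' [w']"
    if "matches s [w]" "(s, s') \<in> step_of inn R" for s s' w
    using simulates[OF that] unfolding list_step_singleton by blast
  show "\<exists>s'. (s, s') \<in> step_of inn R \<and> matches s' [w']"
    if "matches s [w]" "(w, w') \<in> step_of inn (P \<union> U)" for s w w'
    using simulated[OF that(1), of "[w']"] that(2) unfolding list_step_singleton by blast
qed

lemma finitely_branching_step:
  assumes "finite R"
  shows "finitely_branching_on (step_of inn R) s"
    and "finitely_branching_on (step_of inn (P \<union> U)) w"
proof -
  show "finitely_branching_on (step_of inn R) s"
    unfolding finitely_branching_on_def by (simp add: finite_step_of[OF assms vars_rhs])
  have "U \<subseteq> (\<lambda>(l, r). (lift_trm l, lift_trm r)) ` R"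
    using in_U unfolding lift_rules_def by auto
  then have "finite U" by (rule finite_subset) (simp add: assms)
  moreover have "finite P" using assms unfolding P_def weak_pairs_parts by simp
  ultimately have finite: "finite (P \<union> U)" by simp
  have "finite {v. (u, v) \<in> step_of inn (P \<union> U)}" for u
    using finite vars_extended_rhs by (rule finite_step_of)
  then show "finitely_branching_on (step_of inn (P \<union> U)) w"
    unfolding finitely_branching_on_def by blast
qed

lemma dh_sharp:
  assumes "finite R" and "t \<in> basic_terms F ar R" and "terminating_on (step_of inn R) t"
  shows "dh_defined t (step_of inn R) \<and> dh_defined (sharp t) (step_of inn (P \<union> U)) \<and>
    dh t (step_of inn R) = dh (sharp t) (step_of inn (P \<union> U))"
proof -
  let ?B = "\<lambda>s w. matches s [w]"
  have t: "?B t (sharp t)" using matches_basic[OF assms(2)] .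
  have "dh t (step_of inn R) = dh (sharp t) (step_of inn (P \<union> U))"
    using bisimulation_dh[of ?B, OF bisimulation_matches t] .
  moreover have "terminating_on (step_of inn (P \<union> U)) (sharp t)"
    using bisimulation_terminating_on[of ?B, OF bisimulation_matches t assms(3)] .
  ultimately show ?thesis
    unfolding dh_defined_def using finitely_branching_step[OF assms(1)] assms(3) by simp
qed

end

theorem theorem34:
  fixes F :: "'f set" and ar :: "'f \<Rightarrow> nat"
    and R :: "('f, 'v :: {countable, infinite}) rule set"
    and t :: "('f, 'v) trm"
    and \<gamma> :: "('f, 'v) rule \<Rightarrow> 'c"
    and P :: "(('f, 'c) dpsym, 'v) rule set"
    and step :: "('f, 'v) trm rel"
    and step_P :: "(('f, 'c) dpsym, 'v) trm rel"
  assumes "finite F" and "\<exists>c \<in> F. ar c = 0"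
    and "is_trs F ar R"
    and "t \<in> basic_terms F ar R"
    and "(step = rstep R \<and> P = WDP \<gamma> R \<and>
            step_P = rstep (P \<union> usable_rules (lift_rules R) P)) \<or>
         (step = irstep R \<and> P = WIDP \<gamma> R \<and>
            step_P = irstep (P \<union> usable_rules (lift_rules R) P))"
    and "terminating_on step t"
  shows "dh_defined t step \<and> dh_defined (sharp t) step_P \<and> dh t step = dh (sharp t) step_P"
proof -
  have rules: "\<exists>f ls. l = Fun f ls" "vars r \<subseteq> vars l" if "(l, r) \<in> R" for l r
  proof -
    have "l \<notin> range Var" "vars r \<subseteq> vars l"
      using assms(3) that unfolding is_trs_def by blast+
    then show "\<exists>f ls. l = Fun f ls" "vars r \<subseteq> vars l"
      by (cases l; simp)+
  qed
  \<comment> \<open>The two alternatives of the hypothesis become the two values of one flag, so a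
    single instance of the locale settles both.\<close>
  obtain inn where inn: "step = step_of inn R"
    "P = weak_pairs (Inl ` defined R \<union> (if inn then {} else range Inr)) \<gamma> R"
    "step_P = step_of inn (P \<union> usable_rules (lift_rules R) P)"
  proof -
    from assms(5) show thesis
    proof
      assume "step = rstep R \<and> P = WDP \<gamma> R \<and>
        step_P = rstep (P \<union> usable_rules (lift_rules R) P)"
      then show thesis using that[of False] by (simp add: step_of_False WDP_def)
    next
      assume "step = irstep R \<and> P = WIDP \<gamma> R \<and>
        step_P = irstep (P \<union> usable_rules (lift_rules R) P)"
      then show thesis using that[of True] by (simp add: step_of_True WIDP_def)
    qed
  qed
  interpret pairs: weak_pairs_of_trs R inn \<gamma>
    by unfold_locales (use rules in blast)+
  have P: "pairs.P = P"
    unfolding pairs.P_def pairs.X_def inn(2) ..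
  have U: "pairs.U = usable_rules (lift_rules R) P"
    unfolding pairs.U_def P ..
  have "finite R" using assms(3) unfolding is_trs_def by blast
  moreover have "terminating_on (step_of inn R) t" using assms(6) unfolding inn(1) .
  ultimately show ?thesis
    using pairs.dh_sharp[of t F ar] assms(4) unfolding P U inn(1,3) by blast
qed

end
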